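(* Let $G$ be a connected $n$-vertex graph of size (number of edges) at least $4+\frac{n(n-5)}{2}$. Then the harmonic center $\mathcal{C}_H(G)$ of $G$ is contained in a single block of $G$ (that is, there is a block of $G$ containing all vertices of $\mathcal{C}_H(G)$).
   Context: Graphs are finite, without loops or multiple edges. For a connected graph $G$, $d(u,v)$ denotes the distance (length of a shortest $u$-$v$-path). The harmonic centrality of a vertex $x$ of $G$ is $H_G(x)=\sum_{u\in V(G),\,u\neq x}\frac{1}{d(u,x)}$. The harmonic center $\mathcal{C}_H(G)$ is the subgraph of $G$ induced by the vertices of $G$ with maximum harmonic centrality. A block of $G$ is a maximal connected subgraph of $G$ that has no cut-vertex of its own. *)

theory Defs
  imports Complex_Main "Graph_Theory.Graph_Theory"
begin

text \<open>
  Finite simple graphs are the locale \<^locale>\<open>graph\<close>: finite symmetric digraphs without loops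
  or parallel arcs. An undirected edge is thus a pair of opposite arcs, and the size of a graph
  counts the unordered pairs of ends of its arcs.
\<close>

definition graph_size :: "('a,'b) pre_digraph \<Rightarrow> nat" where
  "graph_size G = card ((\<lambda>e. {tail G e, head G e}) ` arcs G)"

text \<open>Only meaningful if \<open>v\<close> is reachable from \<open>u\<close>.\<close>

definition graph_dist :: "('a,'b) pre_digraph \<Rightarrow> 'a \<Rightarrow> 'a \<Rightarrow> nat" where
  "graph_dist G u v = (LEAST k. \<exists>p. pre_digraph.apath G u p v \<and> length p = k)"

definition harmonic_centrality :: "('a,'b) pre_digraph \<Rightarrow> 'a \<Rightarrow> real" where
  "harmonic_centrality G x = (\<Sum>u\<in>verts G - {x}. 1 / real (graph_dist G u x))"

definition harmonic_center :: "('a,'b) pre_digraph \<Rightarrow> ('a,'b) pre_digraph" where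
  "harmonic_center G =
     G \<restriction> {x \<in> verts G. \<forall>y\<in>verts G. harmonic_centrality G y \<le> harmonic_centrality G x}"

text \<open>
  A cut-vertex separates two other vertices of the same component. In particular, the vertices
  of graphs with one or two vertices are not cut-vertices.
\<close>

definition cut_vertex :: "('a,'b) pre_digraph \<Rightarrow> 'a \<Rightarrow> bool" where
  "cut_vertex G v \<longleftrightarrow> v \<in> verts G \<and>
     (\<exists>u\<in>verts G - {v}. \<exists>w\<in>verts G - {v}.
        u \<rightarrow>\<^sup>*\<^bsub>G\<^esub> w \<and> \<not> u \<rightarrow>\<^sup>*\<^bsub>pre_digraph.del_vert G v\<^esub> w)"

text \<open>
  The condition \<^term>\<open>graph H\<close> restricts the candidates to undirected subgraphs:
  a \<^const>\<open>subgraph\<close> of a symmetric digraph need not be symmetric.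
\<close>

definition block :: "('a,'b) pre_digraph \<Rightarrow> ('a,'b) pre_digraph \<Rightarrow> bool" where
  "block G B \<longleftrightarrow> pre_digraph.max_subgraph G
     (\<lambda>H. graph H \<and> Digraph_Component.connected H \<and> (\<forall>v. \<not> cut_vertex H v)) B"

end

theory Submission
  imports Defs
begin

text \<open>
  Let \<open>v\<close> be a vertex whose removal leaves two nonempty sets \<open>A\<close> and \<open>B\<close> with no edge between
  them, and let \<open>H\<close> be the harmonic centrality. The core of the proof is that all vertices of one
  of the two sides have smaller centrality than \<open>v\<close> (\<open>one_side_below\<close>), so that the harmonic center
  avoids that side.

  Passing from \<open>x \<in> A\<close> to \<open>v\<close> brings every vertex of \<open>B\<close> closer by at least one step, which gains
  at least \<open>1/2\<close> already for a neighbour of \<open>v\<close> in \<open>B\<close>, and strictly more in total if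
  \<open>B\<close> has a further vertex (\<open>centrality_gain\<close>). Only the vertices of \<open>A\<close> can cause a loss. There is
  none if \<open>v\<close> is adjacent to all of \<open>A\<close> (\<open>dominated_side\<close>), and it is at most \<open>1/2\<close> if \<open>A\<close> has two
  vertices (\<open>two_vertex_side\<close>). A side with one vertex is of the first kind. This leaves the case that
  both sides have at least three vertices, where the number of edges enters: the bound says that at
  most \<open>2n - 4 = 2(a + b) - 2\<close> pairs of vertices are nonadjacent, where \<open>a\<close> and \<open>b\<close> are the sizes
  of the sides. The pairs between \<open>A\<close> and \<open>B\<close> account for \<open>ab\<close> of them, so at most
  \<open>2 - (a - 2)(b - 2) \<le> 1\<close> vertices are nonadjacent to \<open>v\<close>, and \<open>v\<close> is adjacent to a whole side
  (\<open>dense_separation_dominated\<close>).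

  It remains to see that a nonempty set \<open>S\<close> of vertices that is never split by a single vertex lies
  in one block (\<open>contained_in_block\<close>). Discard every side that avoids \<open>S\<close>, for all separations at
  once. Paths between the remaining vertices cannot enter a discarded side, since
  they would have to pass the separating vertex twice. Hence the remaining vertices
  induce a connected subgraph, and a cut-vertex of this subgraph would separate the whole graph,
  so that one of the two vertices it separates would have been discarded. The subgraph has therefore
  no cut-vertex and extends to a block.
\<close>

(* Otherwise every adjacency statement has a second parse as a function set. *)
unbundle no funcset_syntax

section \<open>Distances in connected graphs\<close>

locale connected_graph = graph G for G :: "('a,'b) pre_digraph" (structure) +
  assumes connected: "Digraph_Component.connected G"
begin

lemma reachable_all:
  assumes "u \<in> verts G" "w \<in> verts G"
  shows "u \<rightarrow>\<^sup>* w"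
  using connected assms reachable_mk_symmetric_eq[OF sym_arcs]
  by (auto simp: Digraph_Component.connected_def strongly_connected_def)

lemma reverse_awalk:
  assumes "awalk u p w"
  shows "\<exists>q. awalk w q u \<and> length q = length p"
  using assms
proof (induction p arbitrary: u)
  case Nil
  then show ?case by (intro exI[of _ "[]"]) (auto simp: awalk_Nil_iff)
next
  case (Cons e p)
  then have e: "e \<in> arcs G" "tail G e = u" and "awalk (head G e) p w"
    by (auto simp: awalk_Cons_iff)
  then obtain q where q: "awalk w q (head G e)" "length q = length p"
    using Cons.IH by blast
  obtain e' where "e' \<in> arcs G" "tail G e' = head G e" "head G e' = u"
    using sym_arcs e by (fastforce simp: symmetric_conv)
  then have "awalk (head G e) [e'] u" by (metis arc_implies_awalk)
  then have "awalk w (q @ [e']) u" using q by (intro awalk_appendI)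
  then show ?case using q by (intro exI[of _ "q @ [e']"]) auto
qed

text \<open>
  Distances are defined by paths; this bound allows estimating them by arbitrary walks.
\<close>

lemma length_awalk_to_apath:
  assumes "awalk u p w"
  shows "length (awalk_to_apath p) \<le> length p"
  using assms
proof (induct rule: awalk_to_apath_induct)
  case (path p)
  then have "awalk_to_apath p = p" by (auto simp: awalk_to_apath.simps)
  then show ?case by simp
next
  case (decomp p q r s)
  then have *: "awalk_to_apath p = awalk_to_apath (q @ s)"
    by (intro step_awalk_to_apath)
  have "p = q @ r @ s"
    using decomp(2,1,3) by (rule awalk_cyc_decompE)
  then show ?case using decomp(4) * by simp
qed

lemma dist_le:
  assumes "awalk u p w"
  shows "graph_dist G u w \<le> length p"
proof -
  have "graph_dist G u w \<le> length (awalk_to_apath p)"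
    unfolding graph_dist_def using apath_awalk_to_apath[OF assms] by (intro Least_le) blast
  then show ?thesis using length_awalk_to_apath[OF assms] by linarith
qed

lemma dist_attained:
  assumes "u \<in> verts G" "w \<in> verts G"
  obtains p where "apath u p w" "length p = graph_dist G u w"
proof -
  have "\<exists>k p. apath u p w \<and> length p = k"
    using reachable_all[OF assms] by (auto simp: reachable_apath)
  then have "\<exists>p. apath u p w \<and> length p = graph_dist G u w"
    unfolding graph_dist_def by (rule LeastI_ex)
  then show ?thesis using that by blast
qed

lemma dist_sym:
  assumes "u \<in> verts G" "w \<in> verts G"
  shows "graph_dist G u w = graph_dist G w u"
proof -
  have "graph_dist G w u \<le> graph_dist G u w" if "u \<in> verts G" "w \<in> verts G" for u w
    using dist_attained[OF that] reverse_awalk dist_le awalkI_apath by metis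
  then show ?thesis using assms by (simp add: eq_iff)
qed

lemma dist_pos:
  assumes "u \<in> verts G" "w \<in> verts G" "u \<noteq> w"
  shows "1 \<le> graph_dist G u w"
proof -
  obtain p where p: "apath u p w" "length p = graph_dist G u w"
    using dist_attained assms by blast
  then have "p \<noteq> []" using assms(3) by (auto simp: apath_Nil_iff)
  then show ?thesis using p(2) by (cases p) auto
qed

lemma dist_adjacent:
  assumes "u \<rightarrow> w"
  shows "graph_dist G u w \<le> 1"
proof -
  obtain e where e: "e \<in> arcs G" "tail G e = u" "head G e = w" using assms by blast
  then have "awalk u [e] w" by (metis arc_implies_awalk)
  then show ?thesis using dist_le[of u "[e]" w] by simp
qed

lemma dist_triangle:
  assumes "u \<in> verts G" "v \<in> verts G" "w \<in> verts G"
  shows "graph_dist G u w \<le> graph_dist G u v + graph_dist G v w"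
proof -
  obtain p where p: "apath u p v" "length p = graph_dist G u v"
    using dist_attained assms by blast
  obtain q where q: "apath v q w" "length q = graph_dist G v w"
    using dist_attained assms by blast
  have "awalk u (p @ q) w"
    using awalk_appendI[OF awalkI_apath[OF p(1)] awalkI_apath[OF q(1)]] .
  then have "graph_dist G u w \<le> length (p @ q)" by (rule dist_le)
  then show ?thesis using p(2) q(2) by simp
qed

end

section \<open>Separations by a single vertex\<close>

text \<open>
  The sides are unions of components of the graph without \<open>v\<close>, rather than one component and the
  rest, so that the notion is symmetric in \<open>A\<close> and \<open>B\<close>.
\<close>

definition separation :: "('a,'b) pre_digraph \<Rightarrow> 'a \<Rightarrow> 'a set \<Rightarrow> 'a set \<Rightarrow> bool" where
  "separation G v A B \<longleftrightarrow> v \<notin> A \<union> B \<and> A \<inter> B = {} \<and> insert v (A \<union> B) = verts G \<and>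
     (\<forall>a\<in>A. \<forall>b\<in>B. \<not> a \<rightarrow>\<^bsub>G\<^esub> b)"

context connected_graph
begin

lemma separation_sym: "separation G v A B \<Longrightarrow> separation G v B A"
  unfolding separation_def using graph_symmetric by blast

lemma separation_walk:
  assumes "separation G v A B" "awalk u p w" "u \<in> A" "w \<notin> A"
  shows "v \<in> set (awalk_verts u p)"
  using assms(2,3)
proof (induction p arbitrary: u)
  case Nil
  then show ?case using assms(4) by (auto simp: awalk_Nil_iff)
next
  case (Cons e p)
  then have e: "e \<in> arcs G" "tail G e = u" and w: "awalk (head G e) p w"
    by (auto simp: awalk_Cons_iff)
  have "u \<rightarrow> head G e" using e by (metis in_arcs_imp_in_arcs_ends)
  then have "head G e = v \<or> head G e \<in> A"
    using assms(1) Cons.prems(2) adj_in_verts unfolding separation_def by blast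
  then show ?case using Cons.IH[OF w] hd_in_awalk_verts(1)[OF w] by auto
qed

lemma separation_neighbour:
  assumes "separation G v A B" "A \<noteq> {}"
  obtains a where "a \<in> A" "a \<rightarrow> v"
proof -
  obtain a where a: "a \<in> A" using assms by blast
  have "a \<rightarrow>\<^sup>* v" using assms a unfolding separation_def by (intro reachable_all) blast+
  then have "a \<in> A \<longrightarrow> (\<exists>a\<in>A. a \<rightarrow> v)"
  proof (induct rule: converse_reachable_induct)
    case base
    then show ?case using assms by (auto simp: separation_def)
  next
    case (step x y)
    have "y \<in> insert v A" if "x \<in> A"
      using that assms(1) adj_in_verts(2)[OF step(1)] step(1) unfolding separation_def by blast
    then show ?case using step by blast
  qed
  then show ?thesis using that a by blast
qed

text \<open>
  A path from one side to the other passes \<open>v\<close> and then needs at least one more step.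
\<close>

lemma separation_dist:
  assumes "separation G v A B" "a \<in> A" "b \<in> B"
  shows "graph_dist G b v + 1 \<le> graph_dist G b a"
proof -
  have V: "a \<in> verts G" "b \<in> verts G" "v \<in> verts G" "v \<noteq> a"
    using assms by (auto simp: separation_def)
  obtain p where p: "apath b p a" "length p = graph_dist G b a"
    using dist_attained V by blast
  have "v \<in> set (awalk_verts b p)"
    using separation_walk[OF separation_sym[OF assms(1)] awalkI_apath[OF p(1)]] assms
    by (auto simp: separation_def)
  then obtain q r where qr: "p = q @ r" "awalk b q v" "awalk v r a"
    using awalk_decomp[OF awalkI_apath[OF p(1)]] by blast
  have "graph_dist G b v + graph_dist G v a \<le> length p"
    using dist_le[OF qr(2)] dist_le[OF qr(3)] qr(1) by simp
  then show ?thesis using p(2) dist_pos[of v a] V by linarith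
qed

section \<open>Centrality of a separating vertex\<close>

text \<open>
  The gain on \<open>B\<close> is a sum of positive terms \<open>1/d - 1/(d + k)\<close> with \<open>k \<ge> 1\<close>, where \<open>d\<close> is the
  distance to \<open>v\<close>. A neighbour of \<open>v\<close> alone contributes at least \<open>1 - 1/2\<close>. The terms of \<open>v\<close> in
  the centrality of \<open>x\<close> and of \<open>x\<close> in that of \<open>v\<close> cancel by symmetry of the distance.
\<close>

lemma centrality_gain:
  assumes sep: "separation G v A B" and B: "B \<noteq> {}" and x: "x \<in> A"
  defines "D \<equiv> (\<Sum>u\<in>A - {x}. 1 / real (graph_dist G u v) - 1 / real (graph_dist G u x))"
  shows "harmonic_centrality G x + D + 1 / 2 \<le> harmonic_centrality G v"
    and "2 \<le> card B \<Longrightarrow> harmonic_centrality G x + D + 1 / 2 < harmonic_centrality G v"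
proof -
  let ?d = "graph_dist G"
  define g where "g u = 1 / real (?d u v) - 1 / real (?d u x)" for u
  have V: "verts G = insert v (A \<union> B)" "v \<notin> A" "v \<notin> B" "A \<inter> B = {}" "finite A" "finite B"
    using sep finite_verts unfolding separation_def by (auto simp del: finite_verts dest: sym)
  have v1: "verts G - {v} = insert x ((A - {x}) \<union> B)" and x1: "verts G - {x} = insert v ((A - {x}) \<union> B)"
    using V x by auto
  have "harmonic_centrality G v
      = 1 / real (?d x v) + (\<Sum>u\<in>A - {x}. 1 / real (?d u v)) + (\<Sum>u\<in>B. 1 / real (?d u v))"
    unfolding harmonic_centrality_def v1 using V x
    by (subst sum.insert) (auto simp: sum.union_disjoint Diff_Int_distrib2)
  moreover have "harmonic_centrality G x
      = 1 / real (?d v x) + (\<Sum>u\<in>A - {x}. 1 / real (?d u x)) + (\<Sum>u\<in>B. 1 / real (?d u x))"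
    unfolding harmonic_centrality_def x1 using V x
    by (subst sum.insert) (auto simp: sum.union_disjoint Diff_Int_distrib2)
  moreover have "?d x v = ?d v x" using V x by (intro dist_sym) auto
  ultimately have diff: "harmonic_centrality G v - harmonic_centrality G x = D + sum g B"
    unfolding D_def g_def by (simp add: sum_subtractf)
  have g: "1 / real (?d b v) - 1 / (real (?d b v) + 1) \<le> g b" "0 < g b" if "b \<in> B" for b
  proof -
    have p: "1 \<le> real (?d b v)" using dist_pos[of b v] V that by fastforce
    have q: "real (?d b v) + 1 \<le> real (?d b x)"
      using separation_dist[OF sep x that] by linarith
    show 1: "1 / real (?d b v) - 1 / (real (?d b v) + 1) \<le> g b"
      unfolding g_def using p q by (simp add: frac_le)
    have "0 < 1 / real (?d b v) - 1 / (real (?d b v) + 1)"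
      using p by (simp add: frac_less2)
    then show "0 < g b" using 1 by linarith
  qed
  obtain b where b: "b \<in> B" "b \<rightarrow> v"
    using separation_neighbour[OF separation_sym[OF sep] B] by blast
  have "?d b v = 1"
    using dist_adjacent[OF b(2)] dist_pos[of b v] V b(1) by fastforce
  then have gb: "1 / 2 \<le> g b" using g(1)[OF b(1)] by simp
  have split: "sum g B = g b + sum g (B - {b})"
    using b V by (simp add: sum.remove)
  have "0 \<le> sum g (B - {b})" using g(2) by (intro sum_nonneg) (auto intro: less_imp_le)
  then show "harmonic_centrality G x + D + 1 / 2 \<le> harmonic_centrality G v"
    using diff split gb by linarith
  show "harmonic_centrality G x + D + 1 / 2 < harmonic_centrality G v" if "2 \<le> card B"
  proof -
    have "card (B - {b}) > 0" using that b V by simp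
    then have "0 < sum g (B - {b})" using g(2) V
      by (intro sum_pos) (auto simp: card_gt_0_iff simp del: card_Diff_insert)
    then show ?thesis using diff split gb by linarith
  qed
qed

lemma dominated_side:
  assumes sep: "separation G v A B" and B: "B \<noteq> {}" and adj: "\<forall>a\<in>A. a \<rightarrow> v" and x: "x \<in> A"
  shows "harmonic_centrality G x < harmonic_centrality G v"
proof -
  have "0 \<le> 1 / real (graph_dist G u v) - 1 / real (graph_dist G u x)" if "u \<in> A - {x}" for u
  proof -
    have "u \<in> verts G" "x \<in> verts G" "v \<in> verts G" "u \<noteq> v" "u \<noteq> x"
      using sep x that by (auto simp: separation_def)
    then have "1 \<le> graph_dist G u x" "graph_dist G u v = 1"
      using dist_pos dist_adjacent adj that by (auto simp: le_antisym)
    then show ?thesis by simp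
  qed
  then have "0 \<le> (\<Sum>u\<in>A - {x}. 1 / real (graph_dist G u v) - 1 / real (graph_dist G u x))"
    by (rule sum_nonneg)
  then show ?thesis using centrality_gain(1)[OF sep B x] by linarith
qed

text \<open>
  The second vertex \<open>y\<close> of \<open>A\<close> has distance at most \<open>2\<close> from \<open>v\<close>, because its only possible
  neighbours are \<open>v\<close> and \<open>x\<close>. So the loss at \<open>y\<close> is at most \<open>1 - 1/2\<close>. It is attained when \<open>A\<close> is a
  pendant path at \<open>v\<close>, hence strictness has to come from the second vertex of \<open>B\<close>.
\<close>

lemma two_vertex_side:
  assumes sep: "separation G v A B" and B: "2 \<le> card B" and A: "card A = 2" and x: "x \<in> A"
  shows "harmonic_centrality G x < harmonic_centrality G v"
proof -
  obtain y where y: "A = {x, y}" "x \<noteq> y"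
    using A x by (auto simp: card_2_iff)
  have V: "x \<in> verts G" "y \<in> verts G" "v \<in> verts G" "y \<noteq> v"
    using sep y by (auto simp: separation_def)
  have "graph_dist G y v \<le> 2"
  proof (cases "y \<rightarrow> v")
    case True
    then show ?thesis using dist_adjacent by fastforce
  next
    case False
    then have xv: "x \<rightarrow> v" using separation_neighbour[OF sep] y by blast
    have "y \<rightarrow> x"
    proof -
      obtain w where "y \<rightarrow> w"
        using reachable_all[of y v] V by (auto elim: converse_reachable_cases)
      then have "w \<in> insert v (A \<union> B)" "w \<notin> B" "w \<noteq> v" "w \<noteq> y"
        using False sep y adj_in_verts(2)[of y w] adj_not_same by (auto simp: separation_def)
      then show ?thesis using \<open>y \<rightarrow> w\<close> y by auto
    qed
    then show ?thesis
      using dist_triangle[of y x v] dist_adjacent[OF xv] dist_adjacent[of y x] V by linarith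
  qed
  moreover have "1 \<le> graph_dist G y v" "1 \<le> graph_dist G y x"
    using V y dist_pos by auto
  ultimately have "1 / 2 \<le> 1 / real (graph_dist G y v)" "1 / real (graph_dist G y x) \<le> 1"
    by (auto simp: field_simps)
  moreover have "A - {x} = {y}" using y by auto
  ultimately have "- (1 / 2) \<le> (\<Sum>u\<in>A - {x}. 1 / real (graph_dist G u v) - 1 / real (graph_dist G u x))"
    by simp
  moreover have "B \<noteq> {}" using B by auto
  ultimately show ?thesis using centrality_gain(2)[OF sep _ x B] by linarith
qed

section \<open>Counting edges\<close>

text \<open>
  The edges, the pairs between \<open>A\<close> and \<open>B\<close>, and the nonadjacent pairs containing \<open>v\<close> are disjoint
  families of two-element sets of vertices.
\<close>

lemma size_separation:
  assumes sep: "separation G v A B"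
  defines "N \<equiv> {u \<in> A \<union> B. \<not> u \<rightarrow> v}"
  shows "graph_size G + card A * card B + card N \<le> card (verts G) choose 2"
proof -
  have V: "verts G = insert v (A \<union> B)" "v \<notin> A" "v \<notin> B" "A \<inter> B = {}" "finite A" "finite B"
    using sep finite_verts unfolding separation_def by (auto simp del: finite_verts dest: sym)
  define E where "E = (\<lambda>e. {tail G e, head G e}) ` arcs G"
  define F where "F = (\<lambda>(a, b). {a, b}) ` (A \<times> B)"
  define M where "M = (\<lambda>u. {u, v}) ` N"
  have edge: "a \<rightarrow> b" if ab: "{a, b} \<in> E" for a b
  proof -
    obtain e where e: "{a, b} = {tail G e, head G e}" "e \<in> arcs G"
      using ab unfolding E_def by (rule imageE)
    have "tail G e \<rightarrow> head G e" using e(2) by (rule in_arcs_imp_in_arcs_ends)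
    then have "a \<rightarrow> b \<or> b \<rightarrow> a" using e(1) by (auto simp: doubleton_eq_iff)
    then show ?thesis using graph_symmetric by blast
  qed
  have fin: "finite E" "finite F" "finite M"
    unfolding E_def F_def M_def N_def using V by auto
  have cF: "card F = card A * card B"
    unfolding F_def using V(4)
    by (subst card_image) (auto simp: inj_on_def doubleton_eq_iff card_cartesian_product)
  have cM: "card M = card N"
    unfolding M_def using V by (intro card_image) (auto simp: inj_on_def doubleton_eq_iff N_def)
  have EF: "E \<inter> F = {}" and EM: "E \<inter> M = {}" and FM: "F \<inter> M = {}"
    using edge sep V unfolding F_def M_def N_def separation_def by (auto simp: doubleton_eq_iff)
  have "E \<union> F \<union> M \<subseteq> {S. S \<subseteq> verts G \<and> card S = 2}"
  proof -
    have "S \<subseteq> verts G \<and> card S = 2" if "S \<in> E" for S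
      using that no_loops unfolding E_def by (auto simp: card_2_iff)
    moreover have "S \<subseteq> verts G \<and> card S = 2" if "S \<in> F \<union> M" for S
      using that V unfolding F_def M_def N_def by (auto simp: card_insert_if disjoint_iff)
    ultimately show ?thesis by blast
  qed
  then have "card (E \<union> F \<union> M) \<le> card {S. S \<subseteq> verts G \<and> card S = 2}"
    by (intro card_mono) auto
  also have "\<dots> = card (verts G) choose 2" by (intro n_subsets) simp
  also have "card (E \<union> F \<union> M) = card E + card F + card M"
    using fin EF EM FM by (simp add: card_Un_disjoint Int_Un_distrib2)
  finally show ?thesis unfolding graph_size_def using cF cM by (simp add: E_def)
qed

text \<open>
  Otherwise \<open>v\<close> has a nonneighbour on either side. Together with the \<open>ab\<close> pairs between the sides
  these are more nonadjacent pairs than the bound on the size permits, since it amounts to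
  \<open>(a - 2)(b - 2) \<le> 0\<close> in this situation.
\<close>

lemma dense_separation_dominated:
  assumes sep: "separation G v A B" and A: "3 \<le> card A" and B: "3 \<le> card B"
    and size: "real (graph_size G) \<ge> 4 + real (card (verts G)) * (real (card (verts G)) - 5) / 2"
  shows "(\<forall>a\<in>A. a \<rightarrow> v) \<or> (\<forall>b\<in>B. b \<rightarrow> v)"
proof (rule ccontr)
  assume "\<not> ?thesis"
  then obtain a b where ab: "a \<in> A" "b \<in> B" "\<not> a \<rightarrow> v" "\<not> b \<rightarrow> v" by blast
  have V: "verts G = insert v (A \<union> B)" "v \<notin> A" "v \<notin> B" "A \<inter> B = {}" "finite A" "finite B"
    using sep finite_verts unfolding separation_def by (auto simp del: finite_verts dest: sym)
  have n: "card (verts G) = card A + card B + 1"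
    unfolding V(1) using V by (simp add: card_Un_disjoint)
  have "card {a, b} \<le> card {u \<in> A \<union> B. \<not> u \<rightarrow> v}" using V ab by (intro card_mono) auto
  moreover have "a \<noteq> b" using ab V by auto
  ultimately have "graph_size G + card A * card B + 2 \<le> card (verts G) choose 2"
    using size_separation[OF sep] by simp
  then have "real (graph_size G) + real (card A) * real (card B) + 2 \<le> real (card (verts G) choose 2)"
    by (metis of_nat_add of_nat_le_iff of_nat_mult of_nat_numeral)
  also have "real (card (verts G) choose 2) = real (card (verts G)) * (real (card (verts G)) - 1) / 2"
    unfolding n by (simp add: choose_two real_of_nat_div) (simp add: algebra_simps)
  finally have "(real (card A) - 2) * (real (card B) - 2) \<le> 0"
    using size unfolding n by (simp add: field_simps)
  moreover have "1 * 1 \<le> (real (card A) - 2) * (real (card B) - 2)"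
    using A B by (intro mult_mono) auto
  ultimately show False by simp
qed

lemma one_side_below:
  assumes sep: "separation G v A B" and A: "A \<noteq> {}" and B: "B \<noteq> {}"
    and size: "real (graph_size G) \<ge> 4 + real (card (verts G)) * (real (card (verts G)) - 5) / 2"
  shows "(\<forall>x\<in>A. harmonic_centrality G x < harmonic_centrality G v) \<or>
    (\<forall>x\<in>B. harmonic_centrality G x < harmonic_centrality G v)"
proof (cases "(\<forall>a\<in>A. a \<rightarrow> v) \<or> (\<forall>b\<in>B. b \<rightarrow> v)")
  case True
  then show ?thesis
    using dominated_side[OF sep B] dominated_side[OF separation_sym[OF sep] A] by blast
next
  case False
  have fin: "finite A" "finite B" using sep finite_verts unfolding separation_def
    by (metis finite_Un finite_insert)+
  (* A side with a single vertex is adjacent to v as a whole, by connectedness. *)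
  have "2 \<le> card X" if X: "separation G v X Y" "X \<noteq> {}" "finite X" "\<not> (\<forall>a\<in>X. a \<rightarrow> v)" for X Y
  proof -
    obtain a where "a \<in> X" "a \<rightarrow> v" using separation_neighbour[OF X(1,2)] .
    moreover obtain a' where "a' \<in> X" "\<not> a' \<rightarrow> v" using X(4) by blast
    ultimately have "{a, a'} \<subseteq> X" "card {a, a'} = 2" by (auto simp: card_insert_if)
    then show ?thesis using \<open>finite X\<close> card_mono by metis
  qed
  then have two: "2 \<le> card A" "2 \<le> card B"
    using False sep separation_sym[OF sep] A B fin by blast+
  moreover have "card A = 2 \<or> card B = 2"
    using dense_separation_dominated[OF sep _ _ size] False two by linarith
  ultimately show ?thesis
    using two_vertex_side[OF sep] two_vertex_side[OF separation_sym[OF sep]] by blast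
qed

section \<open>Vertex sets that no vertex splits\<close>

text \<open>
  A path entering \<open>B\<close> from outside and leaving it again would visit \<open>v\<close> twice.
\<close>

lemma separation_convex:
  assumes sep: "separation G v A B" and p: "apath u p w" and u: "u \<notin> B" and w: "w \<notin> B"
  shows "set (awalk_verts u p) \<inter> B = {}"
proof (rule ccontr)
  assume "\<not> ?thesis"
  then obtain z where z: "z \<in> set (awalk_verts u p)" "z \<in> B" by blast
  then obtain q r where qr: "p = q @ r" "awalk u q z" "awalk z r w"
    using awalk_decomp[OF awalkI_apath[OF p]] by blast
  have "v \<in> set (awalk_verts u q)"
  proof (cases "u = v")
    case True
    then show ?thesis using hd_in_awalk_verts(1)[OF qr(2)] by simp
  next
    case False
    then have "u \<in> A" using u sep awalk_hd_in_verts[OF qr(2)] by (auto simp: separation_def)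
    moreover have "z \<notin> A" using z sep by (auto simp: separation_def)
    ultimately show ?thesis using separation_walk[OF sep qr(2)] by blast
  qed
  moreover have "v \<in> set (tl (awalk_verts z r))"
  proof -
    have "v \<in> set (awalk_verts z r)"
      using separation_walk[OF separation_sym[OF sep] qr(3)] z w by blast
    moreover have "hd (awalk_verts z r) = z" "v \<noteq> z"
      using qr(3) z sep by (auto simp: separation_def)
    ultimately show ?thesis by (cases "awalk_verts z r") auto
  qed
  moreover have "awlast u q = z" using qr(2) by simp
  ultimately show False using apath_decomp_disjoint[OF p qr(1)] by blast
qed

lemma graph_induce:
  assumes "W \<subseteq> verts G"
  shows "graph (G \<restriction> W)"
proof -
  have "induced_subgraph (G \<restriction> W) G" using assms by (rule induced_induce)
  then show ?thesis
    using digraphI_induced induced_graph_imp_symmetric[OF sym_arcs] digraph.graphI by blast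
qed

text \<open>
  Take for \<open>A\<close> everything that is still reachable from \<open>u\<close> after the removal of \<open>v\<close>.
\<close>

lemma cut_vertex_separation:
  assumes "v \<in> verts G" "u \<in> verts G - {v}" "w \<in> verts G - {v}" "\<not> u \<rightarrow>\<^sup>*\<^bsub>del_vert v\<^esub> w"
  obtains A B where "separation G v A B" "u \<in> A" "w \<in> B"
proof -
  interpret D: wf_digraph "del_vert v" by (rule wf_digraph_del_vert)
  define A where "A = {y. u \<rightarrow>\<^sup>*\<^bsub>del_vert v\<^esub> y}"
  define B where "B = verts G - {v} - A"
  have sub: "A \<subseteq> verts G - {v}"
    unfolding A_def using D.reachable_in_verts(2) by (auto simp: verts_del_vert)
  have "\<not> a \<rightarrow> b" if a: "a \<in> A" and b: "b \<in> B" for a b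
  proof
    assume "a \<rightarrow> b"
    then obtain e where e: "e \<in> arcs G" "tail G e = a" "head G e = b" by blast
    then have "e \<in> arcs (del_vert v)" using a b sub by (auto simp: arcs_del_vert B_def)
    then have "a \<rightarrow>\<^bsub>del_vert v\<^esub> b"
      using e D.in_arcs_imp_in_arcs_ends by (fastforce simp: tail_del_vert head_del_vert)
    then have "b \<in> A" using a D.reachable_adj_trans unfolding A_def by blast
    then show False using b by (simp add: B_def)
  qed
  then have "separation G v A B"
    using sub assms(1) unfolding separation_def B_def by auto
  moreover have "u \<in> A" using assms(2) by (simp add: A_def verts_del_vert)
  moreover have "w \<in> B" using assms(3,4) by (simp add: B_def A_def)
  ultimately show ?thesis using that by blast
qed

text \<open>
  What remains after discarding all sides that avoid \<open>S\<close>. For a set \<open>S\<close> of vertices this is the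
  intersection of all sets \<open>insert v A\<close> containing \<open>S\<close>, for the separations by \<open>v\<close> into \<open>A\<close> and
  some \<open>B\<close>.
\<close>

definition side_hull :: "'a set \<Rightarrow> 'a set" where
  "side_hull S = {x \<in> verts G. \<forall>v A B. separation G v A B \<longrightarrow> S \<inter> B = {} \<longrightarrow> x \<notin> B}"

lemma side_hull_superset: "S \<subseteq> verts G \<Longrightarrow> S \<subseteq> side_hull S"
  unfolding side_hull_def by blast

lemma side_hull_path:
  assumes "u \<in> side_hull S" "w \<in> side_hull S" "apath u p w"
  shows "set (awalk_verts u p) \<subseteq> side_hull S"
proof
  fix z assume z: "z \<in> set (awalk_verts u p)"
  have "z \<in> verts G" using awalkI_apath[OF assms(3)] z by blast
  moreover have "z \<notin> B" if "separation G v A B" "S \<inter> B = {}" for v A B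
    using separation_convex[OF that(1) assms(3)] assms(1,2) that z
    unfolding side_hull_def by blast
  ultimately show "z \<in> side_hull S" unfolding side_hull_def by blast
qed

lemma side_hull_connected:
  assumes "S \<subseteq> verts G" "S \<noteq> {}"
  shows "Digraph_Component.connected (G \<restriction> side_hull S)"
proof -
  let ?H = "G \<restriction> side_hull S"
  interpret H: graph ?H by (rule graph_induce) (auto simp: side_hull_def)
  have "u \<rightarrow>\<^sup>*\<^bsub>?H\<^esub> w" if u: "u \<in> side_hull S" and w: "w \<in> side_hull S" for u w
  proof -
    have "u \<rightarrow>\<^sup>* w" using u w by (intro reachable_all) (auto simp: side_hull_def)
    then obtain p where p: "apath u p w" by (auto simp: reachable_apath)
    then have "H.awalk u p w"
      using awalk_induce awalkI_apath side_hull_path[OF u w p] by blast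
    then show ?thesis by (rule H.reachable_awalkI)
  qed
  then show ?thesis
    using side_hull_superset[OF assms(1)] assms(2) H.reachable_mk_symmetric_eq[OF H.sym_arcs]
    by (auto simp: Digraph_Component.connected_def strongly_connected_def)
qed

text \<open>
  If \<open>v\<close> separates \<open>u\<close> from \<open>w\<close> in the hull, it does so in the whole graph, as all paths between
  them stay in the hull. One of the two resulting sides avoids \<open>S\<close> and was discarded, although
  it contains \<open>u\<close> or \<open>w\<close>.
\<close>

lemma side_hull_no_cut_vertex:
  assumes S: "\<And>v A B. separation G v A B \<Longrightarrow> S \<inter> A = {} \<or> S \<inter> B = {}"
  shows "\<not> cut_vertex (G \<restriction> side_hull S) v"
proof
  let ?H = "G \<restriction> side_hull S"
  interpret H: graph ?H by (rule graph_induce) (auto simp: side_hull_def)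
  interpret D: wf_digraph "H.del_vert v" by (rule H.wf_digraph_del_vert)
  interpret GD: wf_digraph "del_vert v" by (rule wf_digraph_del_vert)
  assume "cut_vertex ?H v"
  then obtain u w where v: "v \<in> side_hull S" and u: "u \<in> side_hull S - {v}"
    and w: "w \<in> side_hull S - {v}" and nr: "\<not> u \<rightarrow>\<^sup>*\<^bsub>H.del_vert v\<^esub> w"
    unfolding cut_vertex_def by auto
  have "\<not> u \<rightarrow>\<^sup>*\<^bsub>del_vert v\<^esub> w"
  proof
    assume "u \<rightarrow>\<^sup>*\<^bsub>del_vert v\<^esub> w"
    then obtain p where p: "GD.apath u p w" by (auto simp: GD.reachable_apath)
    then have pG: "apath u p w" by (rule subgraph_apath_imp_apath) (rule subgraph_del_vert)
    have hull: "set (awalk_verts u p) \<subseteq> side_hull S"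
      using side_hull_path u w pG by blast
    have av: "GD.awalk_verts u p = awalk_verts u p"
      by (rule fun_cong[OF fun_cong[OF compatible_awalk_verts]])
         (auto simp: compatible_def tail_del_vert head_del_vert)
    have "set (GD.awalk_verts u p) \<subseteq> verts (del_vert v)"
      using GD.awalkI_apath[OF p] by blast
    then have "set (awalk_verts u p) \<subseteq> side_hull S - {v}"
      using hull av by (auto simp: verts_del_vert)
    moreover have "GD.awalk u p w" using p by (rule GD.awalkI_apath)
    ultimately have "pre_digraph.awalk (del_vert v \<restriction> (side_hull S - {v})) u p w"
      using GD.awalk_induce av by simp
    moreover have "del_vert v \<restriction> (side_hull S - {v}) = H.del_vert v"
      by (rule pre_digraph.equality) (auto simp: del_vert_simps H.del_vert_simps)
    ultimately show False using nr D.reachable_awalkI by simp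
  qed
  then obtain A B where AB: "separation G v A B" "u \<in> A" "w \<in> B"
    using cut_vertex_separation[of v u w] u v w by (auto simp: side_hull_def)
  then show False
    using S[OF AB(1)] separation_sym[OF AB(1)] u w unfolding side_hull_def by blast
qed

text \<open>
  Among the finitely many candidates that contain \<open>H\<close>, one with the largest total number of vertices
  and arcs is maximal.
\<close>

lemma block_extension:
  assumes "subgraph H G" "graph H" "Digraph_Component.connected H" "\<forall>v. \<not> cut_vertex H v"
  obtains B where "block G B" "verts H \<subseteq> verts B"
proof -
  define P where "P K \<longleftrightarrow> graph K \<and> Digraph_Component.connected K \<and> (\<forall>v. \<not> cut_vertex K v)"
    for K :: "('a,'b) pre_digraph"
  define Q where "Q K \<longleftrightarrow> subgraph H K \<and> subgraph K G \<and> P K" for K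
  define m where "m K = card (verts K) + card (arcs K)" for K :: "('a,'b) pre_digraph"
  have "Q H" using assms wf_digraph.subgraph_refl unfolding Q_def P_def by (metis subgraph_def)
  moreover have "\<forall>K. Q K \<longrightarrow> m K \<le> card (verts G) + card (arcs G)"
    unfolding Q_def m_def by (auto simp: subgraph_def intro!: add_mono card_mono)
  ultimately obtain B where B: "Q B" "\<And>K. Q K \<Longrightarrow> m K \<le> m B"
    using ex_has_greatest_nat[of Q H m] by (metis less_Suc_eq_le)
  have "max_subgraph P B"
  proof (rule max_subgraphI)
    show "P B" "subgraph B G" using B(1) by (auto simp: Q_def)
    fix K assume K: "B \<noteq> K" "subgraph B K" "subgraph K G"
    show "\<not> P K"
    proof
      assume "P K"
      then have "m K \<le> m B"
        using B K by (auto simp: Q_def intro: subgraph_trans)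
      moreover have sub: "verts B \<subseteq> verts K" "arcs B \<subseteq> arcs K" "finite (verts K)" "finite (arcs K)"
        and comp: "tail B = tail K" "head B = head K"
        using K(2,3) finite_subset[OF _ finite_verts] finite_subset[OF _ finite_arcs]
        by (auto simp: subgraph_def compatible_def)
      ultimately have "card (verts B) = card (verts K)" "card (arcs B) = card (arcs K)"
        using card_mono[OF sub(3,1)] card_mono[OF sub(4,2)] by (auto simp: m_def)
      then have "verts B = verts K" "arcs B = arcs K"
        using sub card_subset_eq by metis+
      then have "B = K" using comp by (intro pre_digraph.equality) auto
      then show False using K(1) by simp
    qed
  qed
  moreover have "verts H \<subseteq> verts B" using B(1) by (auto simp: Q_def)
  ultimately show ?thesis using that unfolding block_def P_def by blast
qed

lemma contained_in_block:
  assumes "S \<subseteq> verts G" "S \<noteq> {}"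
    and "\<And>v A B. separation G v A B \<Longrightarrow> S \<inter> A = {} \<or> S \<inter> B = {}"
  obtains B where "block G B" "S \<subseteq> verts B"
proof -
  have sub: "side_hull S \<subseteq> verts G" by (auto simp: side_hull_def)
  have "\<forall>v. \<not> cut_vertex (G \<restriction> side_hull S) v"
    using side_hull_no_cut_vertex assms(3) by blast
  then obtain B where "block G B" "verts (G \<restriction> side_hull S) \<subseteq> verts B"
    using block_extension[OF subgraph_induce_subgraphI[OF sub] graph_induce[OF sub]
        side_hull_connected[OF assms(1,2)]] by blast
  then show ?thesis using that side_hull_superset[OF assms(1)] by auto
qed

end

text \<open>
  The center is nonempty, and a side whose vertices all have smaller centrality than \<open>v\<close> contains
  none of its vertices. So no vertex splits the center.
\<close>

theorem corollary2:
  fixes G :: "('a, 'b) pre_digraph" and n :: nat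
  assumes "graph G"
    and "Digraph_Component.connected G"
    and "card (verts G) = n"
    and "real (graph_size G) \<ge> 4 + real n * (real n - 5) / 2"
  shows "\<exists>B. block G B \<and> verts (harmonic_center G) \<subseteq> verts B"
proof -
  interpret connected_graph G
    using assms(1,2) by (simp add: connected_graph_def connected_graph_axioms_def)
  let ?S = "verts (harmonic_center G)"
  have S: "?S = {x \<in> verts G. \<forall>y\<in>verts G. harmonic_centrality G y \<le> harmonic_centrality G x}"
    by (simp add: harmonic_center_def)
  have "verts G \<noteq> {}"
    using assms(2) by (auto simp: Digraph_Component.connected_def strongly_connected_def)
  then have "Max (harmonic_centrality G ` verts G) \<in> harmonic_centrality G ` verts G"
    by (intro Max_in) auto
  then obtain x where "x \<in> verts G" "harmonic_centrality G x = Max (harmonic_centrality G ` verts G)"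
    by auto
  then have "x \<in> ?S" unfolding S by simp
  then have "?S \<noteq> {}" by blast
  moreover have "?S \<subseteq> verts G" unfolding S by blast
  moreover have "?S \<inter> A = {} \<or> ?S \<inter> B = {}" if "separation G v A B" for v A B
  proof (cases "A = {} \<or> B = {}")
    case False
    have "v \<in> verts G" using that by (auto simp: separation_def)
    then show ?thesis
      using one_side_below[OF that] False assms(3,4) unfolding S by fastforce
  qed auto
  ultimately show ?thesis using contained_in_block by metis
qed

end
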